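(* Let $r,h,g$ be positive integers with $r\ge h+2$ and $g+h<gr$, and put $n=rg$. Then there exists an MR $(n,r,h,1)$-LRC over a field of size \[\ell\le\left(\max\left\{\tilde O\!\left(\tfrac nr\right),\ (2r)^{\lfloor\frac{h+1}{2}\rfloor}\right\}\right)^{\min\{h,\frac nr\}}.\]
   Context: $\tilde O(f)$ denotes $f\cdot(\log f)^{O(1)}$. Definition: let $\ell$ be a prime power, $a,g,r,h$ positive integers with $ga+h<gr$, $n=gr$, $k=n-ga-h$. An MR (maximally recoverable) $(n,r,h,a)_\ell$-LRC is an $[n,k]$ linear code over $\mathbb{F}_\ell$ with a parity-check matrix $H$ of the block form whose first $ga$ rows are block diagonal with diagonal blocks $A_1,\dots,A_g$ (each $a\times r$, coordinates split into $g$ consecutive groups of size $r$) and whose last $h$ rows are $(D_1|\cdots|D_g)$ with each $D_i$ of size $h\times r$, such that (i) each $A_i$ generates an $[r,a,r-a+1]_\ell$ MDS code, and (ii) every set of $ag+h$ columns of $H$ consisting of any $a$ columns from each group together with any $h$ further columns is linearly independent over $\mathbb{F}_\ell$. "Over a field of size $\ell$" means an MR $(n,r,h,a)_\ell$-LRC. *)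

theory Defs
  imports Complex_Main "HOL-Algebra.Ring"
begin

text \<open>Matrices over a field F (an HOL-Algebra record on nat) are functions
  nat => nat => nat, entry (i,j) = row i, column j.\<close>

definition cols_lin_indep :: "nat ring \<Rightarrow> nat \<Rightarrow> (nat \<Rightarrow> nat \<Rightarrow> nat) \<Rightarrow> nat set \<Rightarrow> bool" where
  "cols_lin_indep F m M S \<longleftrightarrow>
     (\<forall>c \<in> S \<rightarrow> carrier F.
        (\<forall>i<m. (\<Oplus>\<^bsub>F\<^esub> j\<in>S. c j \<otimes>\<^bsub>F\<^esub> M i j) = \<zero>\<^bsub>F\<^esub>) \<longrightarrow> (\<forall>j\<in>S. c j = \<zero>\<^bsub>F\<^esub>))"

definition codeword :: "nat ring \<Rightarrow> nat \<Rightarrow> (nat \<Rightarrow> nat \<Rightarrow> nat) \<Rightarrow> (nat \<Rightarrow> nat) \<Rightarrow> nat \<Rightarrow> nat" where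
  "codeword F a A c j = (\<Oplus>\<^bsub>F\<^esub> i\<in>{0..<a}. c i \<otimes>\<^bsub>F\<^esub> A i j)"

definition hweight :: "nat ring \<Rightarrow> nat \<Rightarrow> (nat \<Rightarrow> nat) \<Rightarrow> nat" where
  "hweight F r w = card {j. j < r \<and> w j \<noteq> \<zero>\<^bsub>F\<^esub>}"

definition generates_MDS :: "nat ring \<Rightarrow> nat \<Rightarrow> nat \<Rightarrow> (nat \<Rightarrow> nat \<Rightarrow> nat) \<Rightarrow> bool" where
  "generates_MDS F a r A \<longleftrightarrow>
     (\<forall>c \<in> {0..<a} \<rightarrow> carrier F.
        (\<forall>j<r. codeword F a A c j = \<zero>\<^bsub>F\<^esub>) \<longrightarrow> (\<forall>i<a. c i = \<zero>\<^bsub>F\<^esub>)) \<and>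
     Min {hweight F r (codeword F a A c) | c. c \<in> {0..<a} \<rightarrow> carrier F \<and> (\<exists>i<a. c i \<noteq> \<zero>\<^bsub>F\<^esub>)}
       = r - a + 1"

text \<open>H is a parity-check matrix of an MR (n,r,h,a)-LRC over F, n = g*r.
  Rows 0..<g*a form the block diagonal part (row i belongs to local group i div a),
  rows g*a..<g*a+h are the global rows (D_1|...|D_g). Column j lies in group j div r.
  Block t's matrix A_t is (\<lambda>i j. H (t*a+i) (t*r+j)).\<close>
definition MR_LRC_pcm :: "nat ring \<Rightarrow> nat \<Rightarrow> nat \<Rightarrow> nat \<Rightarrow> nat \<Rightarrow> (nat \<Rightarrow> nat \<Rightarrow> nat) \<Rightarrow> bool" where
  "MR_LRC_pcm F g r h a H \<longleftrightarrow>
     (\<forall>i<g*a+h. \<forall>j<g*r. H i j \<in> carrier F) \<and>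
     (\<forall>i<g*a. \<forall>j<g*r. i div a \<noteq> j div r \<longrightarrow> H i j = \<zero>\<^bsub>F\<^esub>) \<and>
     (\<forall>t<g. generates_MDS F a r (\<lambda>i j. H (t*a+i) (t*r+j))) \<and>
     (\<forall>S. S \<subseteq> {0..<g*r} \<and> card S = a*g+h \<and>
          (\<forall>t<g. card {j\<in>S. j div r = t} \<ge> a)
          \<longrightarrow> cols_lin_indep F (g*a+h) H S)"

text \<open>There is an MR (n,r,h,a)_\<ell>-LRC with n = g*r (requires g*a+h < g*r).\<close>
definition exists_MR_LRC :: "nat ring \<Rightarrow> nat \<Rightarrow> nat \<Rightarrow> nat \<Rightarrow> nat \<Rightarrow> bool" where
  "exists_MR_LRC F g r h a \<longleftrightarrow> (\<exists>H. MR_LRC_pcm F g r h a H)"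

end

theory Submission
  imports Defs "HOL-Algebra.Algebraic_Closure_Type" "HOL-Library.Z2" "HOL-Library.Function_Algebras"
begin

text \<open>
  Take all-one local rows and, as global rows, the Moore rows \<open>y\<^sub>j ^ (2 ^ k)\<close> for \<open>k < h\<close>. Eliminating one
  column of each group with the local rows leaves a square Moore system in differences
  \<open>y\<^sub>j - y\<^sub>p\<close> inside groups, so the MR property amounts to the linear independence over
  \<open>GF(2)\<close> of any \<open>h\<close> such differences. Choose powers of two \<open>2 ^ s \<ge> r\<close>, distinct \<open>a\<^sub>j\<close> in
  \<open>GF(2 ^ s)\<close>, and \<open>t = (h + 1) div 2\<close>. The BCH vectors \<open>(a\<^sub>j, a\<^sub>j ^ 3, \<dots>, a\<^sub>j ^ (2 t - 1))\<close> handle the columns of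
  a single group; they are mapped additively to scalars \<open>b\<^sub>j\<close> of \<open>GF(Q)\<close>, where
  \<open>Q = max ((2 ^ s) ^ t) (2 ^ v)\<close> with \<open>g \<le> 2 ^ v < 2 g\<close>. At most \<open>m = min h g\<close> groups are involved, and
  they are separated by Vandermonde vectors: \<open>y\<^sub>j = b\<^sub>j (1, x\<^sub>i, \<dots>, x\<^sub>i ^ (m - 1))\<close>, with one \<open>x\<^sub>i\<close> in
  \<open>GF(Q)\<close> per group, read as an element of \<open>GF(Q ^ m)\<close>. Only additivity of these identifications
  matters, so arbitrary additive embeddings replace field extensions. This gives the bound with
  \<open>C = 2\<close> and without the logarithmic factor.
\<close>

subsection \<open>Finite fields of characteristic two\<close>

lemma char_two_add_self:
  fixes x :: "'a::ring_1"
  assumes "CHAR('a) = 2"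
  shows "x + x = 0"
  using add.right_inverse[of x] by (simp only: uminus_CHAR_2[OF assms])

lemma frobenius_add:
  fixes x y :: "'a::comm_ring_1"
  assumes "CHAR('a) = 2"
  shows "(x + y) ^ (2 ^ k) = x ^ (2 ^ k) + y ^ (2 ^ k)"
  by (rule freshmans_dream') (simp_all add: assms)

lemma square_sum:
  fixes f :: "'b \<Rightarrow> 'a::comm_ring_1"
  assumes "CHAR('a) = 2"
  shows "(\<Sum>i\<in>A. f i) ^ 2 = (\<Sum>i\<in>A. f i ^ 2)"
  by (rule freshmans_dream_sum) (simp_all add: assms)

text \<open>The subfield with \<open>2 ^ N\<close> elements of an algebraically closed field of characteristic 2 when
  \<open>N > 0\<close>; for \<open>N = 0\<close> it is the whole type.\<close>
definition GF :: "nat \<Rightarrow> 'a::field set" where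
  "GF N = {x. x ^ (2 ^ N) = x}"

lemma GF_zero [simp]: "0 \<in> GF N"
  and GF_one [simp]: "1 \<in> GF N"
  by (simp_all add: GF_def)

lemma GF_mult [intro]: "x \<in> GF N \<Longrightarrow> y \<in> GF N \<Longrightarrow> x * y \<in> GF N"
  by (simp add: GF_def power_mult_distrib)

lemma GF_inverse [intro]: "x \<in> GF N \<Longrightarrow> inverse x \<in> GF N"
  by (simp add: GF_def power_inverse)

lemma GF_power [intro]: "x \<in> GF N \<Longrightarrow> x ^ k \<in> GF N"
  by (induction k) auto

lemma GF_add:
  fixes x y :: "'a::field"
  assumes "CHAR('a) = 2" "x \<in> GF N" "y \<in> GF N"
  shows "x + y \<in> GF N"
  using assms by (simp add: GF_def frobenius_add)

text \<open>The elements are the roots of \<open>X ^ (2 ^ N) - X\<close>, which splits over an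
  algebraically closed field. Its derivative is the constant \<open>-1\<close>, because
  \<open>2 ^ N\<close> is zero in the field, so no root is repeated.\<close>

lemma card_GF:
  assumes char: "CHAR('a::alg_closed_field) = 2" and "N > 0"
  shows "card (GF N :: 'a::alg_closed_field set) = 2 ^ N" "finite (GF N :: 'a::alg_closed_field set)"
proof -
  define p :: "'a poly" where "p = monom 1 (2 ^ N) - monom 1 1"
  have N: "1 < (2::nat) ^ N" using \<open>N > 0\<close> by (rule one_less_power[rotated]) simp
  have deg: "degree p = 2 ^ N"
    unfolding p_def diff_conv_add_uminus using N
    by (subst degree_add_eq_left) (simp_all add: degree_monom_eq)
  hence p0: "p \<noteq> 0" by auto
  have two: "(2::'a) = 0" using of_nat_CHAR[where ?'a = 'a] char by simp
  have dp: "poly (pderiv p) x = -1" for x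
    using \<open>N > 0\<close> by (simp add: p_def pderiv_diff pderiv_monom two poly_monom)
  obtain A where A: "size A = degree p" "p = smult (lead_coeff p) (\<Prod>x\<in>#A. [:-x, 1:])"
    using alg_closed_imp_factorization[OF p0] by blast
  \<comment> \<open>A double root of \<open>p\<close> would also be a root of its
    derivative.\<close>
  have "count A x \<le> 1" for x
  proof (rule ccontr)
    assume "\<not> count A x \<le> 1"
    hence "{#x, x#} \<subseteq># A" by (auto simp: subseteq_mset_def)
    then obtain B where B: "A = {#x, x#} + B" by (metis subset_mset.le_iff_add)
    have "p = [:-x, 1:] * ([:-x, 1:] * smult (lead_coeff p) (\<Prod>x\<in>#B. [:-x, 1:]))"
      by (subst A(2), subst B) (simp add: algebra_simps del: mult_pCons_left mult_pCons_right)
    then obtain q where "p = [:-x, 1:] * ([:-x, 1:] * q)" by blast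
    hence "poly (pderiv p) x = 0" by (simp add: pderiv_mult del: mult_pCons_left mult_pCons_right)
    thus False using dp[of x] by simp
  qed
  hence count: "count A x = (if x \<in># A then 1 else 0)" for x
    by (metis count_eq_zero_iff le_antisym not_less_eq_eq One_nat_def le_zero_eq)
  have "card (set_mset A) = size A"
    unfolding size_multiset_overloaded_eq by (simp add: count)
  moreover have "set_mset A = GF N"
  proof -
    have "x \<in># A \<longleftrightarrow> poly p x = 0" for x
      by (subst A(2)) (auto simp: poly_prod_mset p0 prod_mset_zero_iff)
    thus ?thesis by (auto simp: GF_def p_def poly_monom)
  qed
  ultimately show "card (GF N :: 'a set) = 2 ^ N" "finite (GF N :: 'a set)"
    using A(1) deg by (simp, metis finite_set_mset)
qed

text \<open>\<open>bit alg_closure\<close> serves as the ambient field in which all the sets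
  \<open>GF N\<close> live.\<close>

lemma char_two_alg_closure_bit: "CHAR(bit alg_closure) = 2"
proof -
  have "CHAR(bit) = 2"
  proof (rule CHAR_eq_posI)
    show "of_nat n \<noteq> (0 :: bit)" if "0 < n" "n < 2" for n
      using that by (cases "n = 1") auto
  qed auto
  thus ?thesis by simp
qed

subsection \<open>Additive embeddings of elementary abelian 2-groups\<close>

text \<open>An additive injection on a subgroup \<open>C\<close> of maximal size is total: otherwise it extends to
  \<open>C \<union> (x + C)\<close> by sending \<open>x\<close> to any element of \<open>B\<close> outside the image of \<open>C\<close>.\<close>
lemma additive_embedding:
  fixes A :: "'a::ab_group_add set" and B :: "'b::ab_group_add set"
  assumes fin: "finite A" "finite B" and card: "card A \<le> card B"
    and A0: "0 \<in> A" and A: "\<And>x y. x \<in> A \<Longrightarrow> y \<in> A \<Longrightarrow> x + y \<in> A" and A2: "\<And>x. x \<in> A \<Longrightarrow> x + x = 0"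
    and B0: "0 \<in> B" and B: "\<And>x y. x \<in> B \<Longrightarrow> y \<in> B \<Longrightarrow> x + y \<in> B" and B2: "\<And>x. x \<in> B \<Longrightarrow> x + x = 0"
  obtains f where "f ` A \<subseteq> B" "inj_on f A" "\<And>x y. x \<in> A \<Longrightarrow> y \<in> A \<Longrightarrow> f (x + y) = f x + f y"
proof -
  define good where "good C f \<longleftrightarrow> C \<subseteq> A \<and> 0 \<in> C \<and> (\<forall>x\<in>C. \<forall>y\<in>C. x + y \<in> C) \<and> f ` C \<subseteq> B \<and>
    inj_on f C \<and> (\<forall>x\<in>C. \<forall>y\<in>C. f (x + y) = f x + f y)" for C and f :: "'a \<Rightarrow> 'b"
  have "good {0} (\<lambda>_. 0)" using A0 B0 by (auto simp: good_def)
  moreover have "\<forall>C. (\<exists>f. good C f) \<longrightarrow> card C < Suc (card A)"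
    using fin by (auto simp: good_def less_Suc_eq_le intro: card_mono)
  ultimately obtain C where "\<exists>f. good C f" and max: "\<And>D. \<exists>f. good D f \<Longrightarrow> card D \<le> card C"
    using ex_has_greatest_nat[of "\<lambda>C. \<exists>f. good C f" "{0}" card "Suc (card A)"] by blast
  then obtain f where f: "good C f" by blast
  have "C = A"
  proof (rule ccontr)
    assume "C \<noteq> A"
    with f obtain x where x: "x \<in> A" "x \<notin> C" by (auto simp: good_def)
    have finC: "finite C" using f fin by (auto simp: good_def intro: finite_subset)
    have "card (f ` C) \<le> card C" using finC by (rule card_image_le)
    also have "card C < card A" using x f fin by (intro psubset_card_mono) (auto simp: good_def)
    finally have "\<not> B \<subseteq> f ` C" using card finC card_mono[of "f ` C" B] by auto
    then obtain y where y: "y \<in> B" "y \<notin> f ` C" by blast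
    have C: "0 \<in> C" "\<And>u v. u \<in> C \<Longrightarrow> v \<in> C \<Longrightarrow> u + v \<in> C" "\<And>u. u \<in> C \<Longrightarrow> u \<in> A"
      and fC: "\<And>u. u \<in> C \<Longrightarrow> f u \<in> B" "inj_on f C" "\<And>u v. u \<in> C \<Longrightarrow> v \<in> C \<Longrightarrow> f (u + v) = f u + f v"
      using f by (auto simp: good_def)
    define D where "D = C \<union> (+) x ` C"
    \<comment> \<open>On the coset, adding \<open>x\<close> undoes the translation by
      \<open>x\<close>, and \<open>y\<close> is the image chosen for \<open>x\<close>.\<close>
    define f' where "f' z = (if z \<in> C then f z else f (z + x) + y)" for z
    have xx: "x + x = 0" "y + y = 0" using x y A2 B2 by auto
    have cancel: "x + (x + u) = u" "y + (y + v) = v" for u v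
      using xx by (simp_all flip: add.assoc)
    have cancel': "x + u + x = u" for u using cancel(1)[of u] by (simp add: ac_simps)
    have xC: "x + u \<notin> C" if "u \<in> C" for u
    proof
      assume "x + u \<in> C"
      hence "x + u + u \<in> C" using C(2) that by blast
      moreover have "u + u = 0" using A2 C(3) that by blast
      ultimately show False using x(2) by (simp add: add.assoc)
    qed
    have f'1: "f' u = f u" and f'2: "f' (x + u) = f u + y" if "u \<in> C" for u
      using that xC by (auto simp: f'_def cancel')
    have ff: "f u + f u = 0" if "u \<in> C" for u using fC B2 that by auto
    \<comment> \<open>The images of \<open>C\<close> and of its coset are disjoint: otherwise
      \<open>y = f (u + v)\<close>, against the choice of \<open>y\<close>.\<close>
    have yC: "f u \<noteq> f v + y" if "u \<in> C" "v \<in> C" for u v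
    proof
      assume "f u = f v + y"
      hence "f (u + v) = y + (f v + f v)" using that by (simp add: fC add_ac)
      hence "f (u + v) = y" using ff[OF that(2)] by simp
      thus False using y C that by blast
    qed
    have "good D f'"
      unfolding good_def
    proof (intro conjI ballI)
      show "D \<subseteq> A" using C A x by (auto simp: D_def)
      show "0 \<in> D" using C by (simp add: D_def)
      show "f' ` D \<subseteq> B" using fC B y by (auto simp: D_def f'1 f'2)
      show "inj_on f' D"
      proof (rule inj_onI)
        fix u v assume uv: "u \<in> D" "v \<in> D" "f' u = f' v"
        consider "u \<in> C" "v \<in> C" | v' where "u \<in> C" "v' \<in> C" "v = x + v'"
          | u' where "u' \<in> C" "v \<in> C" "u = x + u'"
          | u' v' where "u' \<in> C" "v' \<in> C" "u = x + u'" "v = x + v'"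
          using uv unfolding D_def by blast
        thus "u = v"
        proof cases
          case 1 thus ?thesis using uv f'1 fC(2) by (auto dest: inj_onD)
        next
          case 2
        hence "f u = f v' + y" using uv f'1 f'2 by simp
        thus ?thesis using 2 yC by blast
        next
          case 3
        hence "f v = f u' + y" using uv f'1 f'2 by simp
        thus ?thesis using 3 yC by blast
        next
          case 4 thus ?thesis using uv f'2 fC(2) by (auto dest: inj_onD)
        qed
      qed
      fix u v assume uv: "u \<in> D" "v \<in> D"
      consider "u \<in> C" "v \<in> C" | v' where "u \<in> C" "v' \<in> C" "v = x + v'"
        | u' where "u' \<in> C" "v \<in> C" "u = x + u'"
        | u' v' where "u' \<in> C" "v' \<in> C" "u = x + u'" "v = x + v'"
        using uv unfolding D_def by blast
      hence "u + v \<in> D \<and> f' (u + v) = f' u + f' v"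
      proof cases
        case 1 thus ?thesis by (simp add: D_def f'1 fC C)
      next
        case (2 v')
        hence eq: "u + v = x + (u + v')" by (simp add: ac_simps)
        have "f' (u + v) = f u + (f v' + y)"
          unfolding eq using 2 by (subst f'2) (simp_all add: C fC(3) add.assoc)
        thus ?thesis using 2 C(2) eq f'1 f'2 by (simp add: D_def)
      next
        case (3 u')
        hence eq: "u + v = x + (u' + v)" by (simp add: ac_simps)
        have "f' (u + v) = f u' + y + f v"
          unfolding eq using 3 by (subst f'2) (simp_all add: C fC(3) ac_simps)
        thus ?thesis using 3 C(2) eq f'1 f'2 by (simp add: D_def)
      next
        case (4 u' v')
        hence eq: "u + v = u' + v'" using cancel(1)[of "u' + v'"] by (simp add: ac_simps)
        have "f' (u + v) = f u' + f v'" unfolding eq using 4 by (simp add: f'1 C fC(3))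
        also have "\<dots> = (f u' + y) + (f v' + y)"
          using cancel(2)[of "f u' + f v'"] by (simp add: ac_simps)
        also have "\<dots> = f' u + f' v" using 4 f'2 by simp
        finally have "f' (u + v) = f' u + f' v" .
        moreover have "u + v \<in> D" unfolding eq using 4 C(2) by (simp add: D_def)
        ultimately show ?thesis by simp
      qed
      thus "u + v \<in> D" "f' (u + v) = f' u + f' v" by auto
    qed
    hence "card D \<le> card C" using max by blast
    moreover have "card C < card D"
      using finC C(1) x(2) by (intro psubset_card_mono) (auto simp: D_def intro!: image_eqI[of x _ 0])
    ultimately show False by simp
  qed
  thus ?thesis using f that[of f] by (auto simp: good_def)
qed

text \<open>The zero padding makes equality of functions the equality of vectors of length
  \<open>n\<close>; pointwise addition makes them a group when \<open>A\<close> is one, so that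
  \<open>additive_embedding\<close> applies.\<close>

definition vectors :: "'a::zero set \<Rightarrow> nat \<Rightarrow> (nat \<Rightarrow> 'a) set" where
  "vectors A n = {v. (\<forall>i<n. v i \<in> A) \<and> (\<forall>i\<ge>n. v i = 0)}"

lemma card_vectors:
  assumes "finite A"
  shows "card (vectors A n) = card A ^ n" "finite (vectors A n)"
proof -
  have "bij_betw (\<lambda>v i. if i < n then v i else 0) (PiE {..<n} (\<lambda>_. A)) (vectors A n)"
    by (rule bij_betw_byWitness[where f' = "\<lambda>v. restrict v {..<n}"])
      (auto simp: vectors_def fun_eq_iff PiE_def extensional_def)
  moreover have "card (PiE {..<n} (\<lambda>_. A)) = card A ^ n" by (simp add: card_PiE)
  moreover have "finite (PiE {..<n} (\<lambda>_. A))" using assms by (simp add: finite_PiE)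
  ultimately show "card (vectors A n) = card A ^ n" "finite (vectors A n)"
    using bij_betw_same_card bij_betw_finite by fastforce+
qed

text \<open>There are \<open>2 ^ (M * n)\<close> vectors, at most as many as elements of
  \<open>GF N\<close>, and both sides are elementary abelian 2-groups, so comparing sizes is
  enough.\<close>

lemma GF_vectors_embedding:
  assumes char: "CHAR('a::alg_closed_field) = 2" and "M > 0" "N > 0" "M * n \<le> N"
  obtains f :: "(nat \<Rightarrow> 'a::alg_closed_field) \<Rightarrow> 'a" where "\<And>v. v \<in> vectors (GF M) n \<Longrightarrow> f v \<in> GF N"
    "inj_on f (vectors (GF M) n)"
    "\<And>v w. v \<in> vectors (GF M) n \<Longrightarrow> w \<in> vectors (GF M) n \<Longrightarrow> f (v + w) = f v + f w"
proof (rule additive_embedding[of "vectors (GF M) n :: (nat \<Rightarrow> 'a) set" "GF N :: 'a set"])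
  show "card (vectors (GF M) n :: (nat \<Rightarrow> 'a) set) \<le> card (GF N :: 'a set)"
    using assms by (simp add: card_vectors card_GF flip: power_mult)
  show "finite (GF N :: 'a set)" "finite (vectors (GF M) n :: (nat \<Rightarrow> 'a) set)"
    using assms by (simp_all add: card_vectors card_GF)
  fix f :: "(nat \<Rightarrow> 'a) \<Rightarrow> 'a"
  assume "f ` vectors (GF M) n \<subseteq> GF N" "inj_on f (vectors (GF M) n)"
    "\<And>v w. v \<in> vectors (GF M) n \<Longrightarrow> w \<in> vectors (GF M) n \<Longrightarrow> f (v + w) = f v + f w"
  thus thesis using that by blast
next
  show "v + v = 0" for v :: "nat \<Rightarrow> 'a"
    using char_two_add_self[OF char] by (simp add: fun_eq_iff del: mult_2_right flip: mult_2)
qed (use char in \<open>auto simp: vectors_def GF_add char_two_add_self\<close>)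

lemma additive_on_sum:
  fixes f :: "'a::ab_group_add \<Rightarrow> 'b::ab_group_add"
  assumes add: "\<And>x y. x \<in> A \<Longrightarrow> y \<in> A \<Longrightarrow> f (x + y) = f x + f y"
    and A: "\<And>x y. x \<in> A \<Longrightarrow> y \<in> A \<Longrightarrow> x + y \<in> A" "0 \<in> A" and v: "\<And>i. i \<in> I \<Longrightarrow> v i \<in> A"
  shows "f (\<Sum>i\<in>I. v i) = (\<Sum>i\<in>I. f (v i))" "(\<Sum>i\<in>I. v i) \<in> A"
proof -
  have f0: "f 0 = 0" using add[of 0 0] A by simp
  have "f (\<Sum>i\<in>I. v i) = (\<Sum>i\<in>I. f (v i)) \<and> (\<Sum>i\<in>I. v i) \<in> A"
    using v by (induction I rule: infinite_finite_induct) (auto simp: f0 A add)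
  thus "f (\<Sum>i\<in>I. v i) = (\<Sum>i\<in>I. f (v i))" "(\<Sum>i\<in>I. v i) \<in> A" by auto
qed

subsection \<open>Vandermonde and Moore matrices\<close>

text \<open>By linearity the relations extend from powers to all polynomials of degree below
  \<open>m\<close>; the one vanishing at every node except \<open>x j\<close> isolates
  \<open>w j\<close>.\<close>

lemma vandermonde_independent:
  fixes x w :: "'b \<Rightarrow> 'a::field"
  assumes "finite I" "inj_on x I" "card I \<le> m"
    and van: "\<And>l. l < m \<Longrightarrow> (\<Sum>i\<in>I. w i * x i ^ l) = 0" and "j \<in> I"
  shows "w j = 0"
proof -
  have poly: "(\<Sum>i\<in>I. w i * poly p (x i)) = 0" if "degree p < m" for p
  proof -
    have "(\<Sum>i\<in>I. w i * poly p (x i)) = (\<Sum>i\<in>I. \<Sum>l\<le>degree p. coeff p l * (w i * x i ^ l))"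
      by (simp add: poly_altdef sum_distrib_left mult_ac)
    also have "\<dots> = (\<Sum>l\<le>degree p. coeff p l * (\<Sum>i\<in>I. w i * x i ^ l))"
      by (subst sum.swap) (simp add: sum_distrib_left)
    also have "\<dots> = 0" using that van by (intro sum.neutral) auto
    finally show ?thesis .
  qed
  define p where "p = (\<Prod>i\<in>I - {j}. [:- x i, 1:])"
  have "degree p = card (I - {j})" unfolding p_def by (subst degree_prod_eq_sum_degree) auto
  hence "degree p < m" using assms by (metis card_Diff1_less order_less_le_trans)
  hence "0 = (\<Sum>i\<in>I. w i * poly p (x i))" using poly by simp
  also have "\<dots> = (\<Sum>i\<in>{j}. w i * poly p (x i))"
    using assms by (intro sum.mono_neutral_right) (auto simp: p_def poly_prod)
  also have "\<dots> = w j * poly p (x j)" by simp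
  finally show ?thesis
    using assms by (auto simp: p_def poly_prod inj_on_def)
qed

text \<open>Normalise a coefficient of a relation to 1 and subtract the relation from its square: this
  drops one column and one row, so by induction \<open>d\<^sup>2 = d\<close> for every coefficient \<open>d\<close>, and the
  relation is a vanishing subset sum.\<close>
lemma moore_independent:
  fixes y c :: "'b \<Rightarrow> 'a::field"
  assumes char: "CHAR('a) = 2" and "finite I"
    and ind: "\<And>T. T \<subseteq> I \<Longrightarrow> (\<Sum>i\<in>T. y i) = 0 \<Longrightarrow> T = {}"
    and moore: "\<And>k. k < card I \<Longrightarrow> (\<Sum>i\<in>I. c i * y i ^ (2 ^ k)) = 0" and "j \<in> I"
  shows "c j = 0"
  using \<open>finite I\<close> ind moore \<open>j \<in> I\<close>
proof (induction I arbitrary: y c j rule: finite_induct)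
  case (insert i I)
  have ci: "c i = 0"
  proof (rule ccontr)
    assume ci: "c i \<noteq> 0"
    define d where "d z = c z / c i" for z
    have di: "d i = 1" using ci by (simp add: d_def)
    have d: "(\<Sum>z\<in>insert i I. d z * y z ^ (2 ^ k)) = 0" if "k \<le> card I" for k
      using insert.prems(2)[of k] that insert.hyps
      by (simp only: d_def times_divide_eq_left sum_divide_distrib[symmetric]) simp
    \<comment> \<open>Squaring relation \<open>k\<close> and subtracting relation
      \<open>k + 1\<close> gives coefficients \<open>d z ^ 2 - d z\<close> on the squares of
      \<open>y\<close>. The term at \<open>i\<close> drops out as \<open>d i = 1\<close>, and a
      vanishing subset sum of squares is the square of a vanishing subset sum.\<close>
    have d01: "d z ^ 2 - d z = 0" if "z \<in> I" for z
    proof (rule insert.IH[where y = "\<lambda>z. y z ^ 2"])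
      show "T = {}" if "T \<subseteq> I" "(\<Sum>i\<in>T. y i ^ 2) = 0" for T
        using that insert.prems(1)[of T] square_sum[OF char, of y T] by auto
      show "(\<Sum>z\<in>I. (d z ^ 2 - d z) * (y z ^ 2) ^ (2 ^ k)) = 0" if "k < card I" for k
      proof -
        have "(\<Sum>z\<in>insert i I. (d z * y z ^ (2 ^ k)) ^ 2) = 0"
          using square_sum[OF char, of "\<lambda>z. d z * y z ^ (2 ^ k)" "insert i I"] d[of k] that by simp
        hence "(\<Sum>z\<in>insert i I. d z ^ 2 * y z ^ (2 ^ Suc k)) = 0"
          by (simp add: power_mult_distrib mult.commute flip: power_mult)
        moreover have "(\<Sum>z\<in>insert i I. d z * y z ^ (2 ^ Suc k)) = 0" using d[of "Suc k"] that by simp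
        ultimately have "(\<Sum>z\<in>insert i I. (d z ^ 2 - d z) * y z ^ (2 ^ Suc k)) = 0"
          by (simp only: left_diff_distrib sum_subtractf) simp
        thus ?thesis using insert.hyps di by (simp flip: power_mult)
      qed
    qed (use that in auto)
    \<comment> \<open>Each \<open>d z\<close> is 0 or 1, so row \<open>k = 0\<close> is the subset
      sum over \<open>T\<close>, and \<open>T\<close> contains \<open>i\<close>.\<close>
    define T where "T = {z \<in> insert i I. d z = 1}"
    have "d z = (if z \<in> T then 1 else 0)" if "z \<in> insert i I" for z
      using d01[of z] that di by (auto simp: T_def power2_eq_square)
    hence "(\<Sum>z\<in>insert i I. d z * y z) = (\<Sum>z\<in>insert i I. if z \<in> T then y z else 0)"
      by (intro sum.cong) auto
    also have "\<dots> = (\<Sum>z\<in>T. y z)"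
      using insert.hyps by (subst sum.inter_restrict[symmetric]) (auto simp: T_def intro!: sum.cong)
    finally have "(\<Sum>z\<in>T. y z) = 0" using d[of 0] by (simp del: sum.insert)
    hence "T = {}" by (intro insert.prems(1)) (auto simp: T_def)
    thus False using di by (auto simp: T_def)
  qed
  show ?case
  proof (cases "j = i")
    case False
    have "(\<Sum>z\<in>I. c z * y z ^ (2 ^ k)) = 0" if "k < card I" for k
      using insert.prems(2)[of k] that insert.hyps ci by simp
    thus ?thesis
      using insert.prems False by (intro insert.IH[of y c j]) (auto intro: insert.prems(1))
  qed (use ci in simp)
qed simp

subsection \<open>The column generators\<close>

text \<open>The BCH argument: squaring yields the even power sums from the odd ones, and the even size of
  \<open>T\<close> yields the zeroth.\<close>
lemma odd_power_sums_independent: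
  fixes x :: "'b \<Rightarrow> 'a::field"
  assumes char: "CHAR('a) = 2" and "finite T" "inj_on x T" "card T \<le> 2 * t + 1" "even (card T)"
    and odd: "\<And>k. k < t \<Longrightarrow> (\<Sum>i\<in>T. x i ^ (2 * k + 1)) = 0"
  shows "T = {}"
proof -
  have "(\<Sum>i\<in>T. x i ^ e) = 0" if "e < 2 * t + 1" for e
    using that
  proof (induction e rule: less_induct)
    case (less e)
    show ?case
    proof (cases "e = 0")
      case True
      have "of_nat (card T) = (0::'a)" using assms by (simp add: of_nat_eq_0_iff_char_dvd)
      thus ?thesis using True by simp
    next
      case False
      show ?thesis
      proof (cases "even e")
        case True
        then obtain f where f: "e = f * 2" by (metis dvd_div_mult_self)
        have "(\<Sum>i\<in>T. x i ^ f) ^ 2 = (\<Sum>i\<in>T. x i ^ e)"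
          by (simp add: square_sum[OF char] f power_mult)
        thus ?thesis using less.IH[of f] less.prems False f by simp
      next
        case False
        then obtain k where "e = 2 * k + 1" by (elim oddE)
        thus ?thesis using odd[of k] less.prems by simp
      qed
    qed
  qed
  \<comment> \<open>The power sums form a Vandermonde relation with all coefficients 1 on at most
    \<open>2 * t + 1\<close> distinct nodes.\<close>
  hence "(1::'a) = 0" if "j \<in> T" for j
    using vandermonde_independent[of T x "2 * t + 1" "\<lambda>_. 1" j] assms that by simp
  thus ?thesis by auto
qed

section \<open>Generators that separate the groups and the columns within a group\<close>

lemma sum_fun_apply: "(\<Sum>i\<in>I. f i) x = (\<Sum>i\<in>I. f i x)"
  by (induction I rule: infinite_finite_induct) auto

lemma vectors_GF_closed:
  assumes "CHAR('a::field) = 2"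
  shows "0 \<in> vectors (GF N :: 'a::field set) n"
    "v \<in> vectors (GF N :: 'a::field set) n \<Longrightarrow> w \<in> vectors (GF N) n \<Longrightarrow> v + w \<in> vectors (GF N) n"
  using assms by (auto simp: vectors_def GF_add)

text \<open>The conclusion supplies the subset sum hypothesis of \<open>moore_independent\<close>
  for differences to a pivot \<open>p i\<close> of each group, written with plus since the
  characteristic is two. The Vandermonde factor reduces a vanishing sum to single groups, where the
  BCH vectors finish.\<close>

lemma column_generators:
  fixes g r h s t u m :: nat
  assumes char: "CHAR('a::alg_closed_field) = 2"
    and "s > 0" "r \<le> 2 ^ s" "u > 0" "s * t \<le> u" "g \<le> 2 ^ u" "m > 0" "min h g \<le> m" "h \<le> 2 * t"
  obtains y :: "nat \<Rightarrow> 'a::alg_closed_field" where "\<And>j. j < g * r \<Longrightarrow> y j \<in> GF (u * m)"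
    and "\<And>T p. T \<subseteq> {..<g * r} \<Longrightarrow> card T \<le> h \<Longrightarrow>
      (\<And>j. j \<in> T \<Longrightarrow> p (j div r) < g * r \<and> p (j div r) div r = j div r \<and> p (j div r) \<notin> T) \<Longrightarrow>
      (\<Sum>j\<in>T. y j + y (p (j div r))) = 0 \<Longrightarrow> T = {}"
proof -
  \<comment> \<open>\<open>a\<close> labels the positions inside a group, \<open>x\<close> below
    labels the groups.\<close>
  have "\<exists>a::nat \<Rightarrow> 'a. a ` {..<r} \<subseteq> GF s \<and> inj_on a {..<r}"
    using assms by (intro card_le_inj) (simp_all add: card_GF)
  then obtain a :: "nat \<Rightarrow> 'a" where a: "\<And>j. j < r \<Longrightarrow> a j \<in> GF s" "inj_on a {..<r}" by blast
  have "\<exists>x::nat \<Rightarrow> 'a. x ` {..<g} \<subseteq> GF u \<and> inj_on x {..<g}"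
    using assms by (intro card_le_inj) (simp_all add: card_GF)
  then obtain x :: "nat \<Rightarrow> 'a" where x: "\<And>i. i < g \<Longrightarrow> x i \<in> GF u" "inj_on x {..<g}" by blast
  obtain \<phi> :: "(nat \<Rightarrow> 'a) \<Rightarrow> 'a" where \<phi>: "\<And>v. v \<in> vectors (GF s) t \<Longrightarrow> \<phi> v \<in> GF u"
    "inj_on \<phi> (vectors (GF s) t)"
    "\<And>v w. v \<in> vectors (GF s) t \<Longrightarrow> w \<in> vectors (GF s) t \<Longrightarrow> \<phi> (v + w) = \<phi> v + \<phi> w"
    using GF_vectors_embedding[OF char, of s u t] assms by blast
  obtain \<psi> :: "(nat \<Rightarrow> 'a) \<Rightarrow> 'a" where \<psi>: "\<And>v. v \<in> vectors (GF u) m \<Longrightarrow> \<psi> v \<in> GF (u * m)"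
    "inj_on \<psi> (vectors (GF u) m)"
    "\<And>v w. v \<in> vectors (GF u) m \<Longrightarrow> w \<in> vectors (GF u) m \<Longrightarrow> \<psi> (v + w) = \<psi> v + \<psi> w"
    using GF_vectors_embedding[OF char, of u "u * m" m] assms by (metis nat_0_less_mult_iff order_refl)
  note V = vectors_GF_closed[OF char]
  have zero: "\<phi> 0 = 0" "\<psi> 0 = 0" using \<phi>(3)[OF V(1) V(1)] \<psi>(3)[OF V(1) V(1)]
    by (simp_all only: add_0_left add_cancel_right_right)
  \<comment> \<open>\<open>b j\<close> depends only on the position \<open>j mod r\<close>;
    \<open>col j\<close> is the Vandermonde vector of the group \<open>j div r\<close>, scaled by
    \<open>\<phi> (b j)\<close>.\<close>
  define b where "b j = (\<lambda>k. if k < t then a (j mod r) ^ (2 * k + 1) else 0)" for j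
  define col where "col j = (\<lambda>l. if l < m then \<phi> (b j) * x (j div r) ^ l else 0)" for j
  define y where "y j = \<psi> (col j)" for j
  have r: "0 < r" "j div r < g" if "j < g * r" for j
    using that by (cases "r = 0"; auto simp: less_mult_imp_div_less)+
  have b: "b j \<in> vectors (GF s) t" if "j < g * r" for j
    using r[OF that] by (auto simp: vectors_def b_def intro!: GF_mult GF_power a)
  have col: "col j \<in> vectors (GF u) m" if "j < g * r" for j
    using r[OF that] by (auto simp: vectors_def col_def intro!: GF_mult GF_power x \<phi> b that)
  show ?thesis
  proof (rule that[of y])
    show "y j \<in> GF (u * m)" if "j < g * r" for j
      unfolding y_def using col[OF that] by (rule \<psi>)
  next
    fix T p
    assume T: "T \<subseteq> {..<g * r}" "card T \<le> h"
      and p: "\<And>j. j \<in> T \<Longrightarrow> p (j div r) < g * r \<and> p (j div r) div r = j div r \<and> p (j div r) \<notin> T"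
      and sum: "(\<Sum>j\<in>T. y j + y (p (j div r))) = 0"
    have finT: "finite T" using T finite_subset by blast
    have Tlt: "j < g * r" if "j \<in> T" for j using T that by auto
    define q where "q j = p (j div r)" for j
    have q: "q j < g * r" "q j div r = j div r" "q j \<notin> T" if "j \<in> T" for j
      using p[OF that] by (auto simp: q_def)
    have hom: "\<psi> (\<Sum>j\<in>T. col j + col (q j)) = (\<Sum>j\<in>T. \<psi> (col j + col (q j)))"
      and in_V: "(\<Sum>j\<in>T. col j + col (q j)) \<in> vectors (GF u) m"
      using Tlt q(1) by (intro additive_on_sum[OF \<psi>(3) V(2) V(1)] V(2) col; simp)+
    have "\<psi> (\<Sum>j\<in>T. col j + col (q j)) = 0"
      unfolding hom using sum Tlt q(1) by (simp add: \<psi>(3) col y_def q_def cong: sum.cong)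
    hence "(\<Sum>j\<in>T. col j + col (q j)) = 0"
      using \<psi>(2) in_V V(1) zero by (metis inj_onD)
    hence "(\<Sum>j\<in>T. col j + col (q j)) l = 0" for l by simp
    hence col0: "(\<Sum>j\<in>T. col j l + col (q j) l) = 0" for l by (simp add: sum_fun_apply)
    define W where "W j = \<phi> (b j) + \<phi> (b (q j))" for j
    define I where "I = (\<lambda>j. j div r) ` T"
    \<comment> \<open>\<open>T\<close> meets at most \<open>min h g\<close> groups, so
      \<open>m\<close> Vandermonde rows suffice.\<close>
    have "card I \<le> card T" unfolding I_def using finT by (rule card_image_le)
    moreover have I: "I \<subseteq> {..<g}" using Tlt r(2) by (auto simp: I_def)
    hence "card I \<le> g" using card_mono[of "{..<g}" I] by simp
    ultimately have card_I: "card I \<le> m" using assms T by linarith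
    \<comment> \<open>As \<open>q j\<close> lies in the group of \<open>j\<close>,
      \<open>col j + col (q j)\<close> is \<open>W j\<close> times the Vandermonde vector of that
      group. Collecting by groups gives a relation between distinct nodes.\<close>
    have W0: "(\<Sum>j | j \<in> T \<and> j div r = i. W j) = 0" if "i \<in> I" for i
    proof (rule vandermonde_independent[where I = I and x = x and m = m])
      show "finite I" "inj_on x I" "card I \<le> m" "i \<in> I"
        using finT x I card_I that by (auto simp: I_def intro: inj_on_subset)
      fix l assume l: "l < m"
      have "(\<Sum>i\<in>I. (\<Sum>j | j \<in> T \<and> j div r = i. W j) * x i ^ l) =
        (\<Sum>i\<in>I. \<Sum>j | j \<in> T \<and> j div r = i. W j * x (j div r) ^ l)"
        by (simp add: sum_distrib_right)
      also have "\<dots> = (\<Sum>j\<in>T. W j * x (j div r) ^ l)"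
        using finT by (intro sum.group) (auto simp: I_def)
      also have "\<dots> = (\<Sum>j\<in>T. col j l + col (q j) l)"
        using l q by (intro sum.cong) (auto simp: col_def W_def algebra_simps)
      finally show "(\<Sum>i\<in>I. (\<Sum>j | j \<in> T \<and> j div r = i. W j) * x i ^ l) = 0"
        using col0 by simp
    qed
    show "T = {}"
    proof (rule ccontr)
      assume "T \<noteq> {}"
      then obtain j0 where j0: "j0 \<in> T" by blast
      define i where "i = j0 div r"
      define Ti where "Ti = {j \<in> T. j div r = i}"
      define z where "z = q j0"
      have finTi: "finite Ti" using finT by (simp add: Ti_def)
      have Ti: "j < g * r" "j div r = i" "q j = z" if "j \<in> Ti" for j
        using that Tlt by (auto simp: Ti_def z_def q_def i_def)
      have z: "z < g * r" "z div r = i" "z \<notin> Ti" using q[OF j0] by (auto simp: Ti_def z_def i_def)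
      \<comment> \<open>All columns in \<open>Ti\<close> share the pivot \<open>z\<close>, so
        additivity and injectivity of \<open>\<phi>\<close> turn the vanishing scalar into a
        vanishing sum of BCH vectors.\<close>
      have hom: "\<phi> (\<Sum>j\<in>Ti. b j + b z) = (\<Sum>j\<in>Ti. \<phi> (b j + b z))"
        and in_V: "(\<Sum>j\<in>Ti. b j + b z) \<in> vectors (GF s) t"
        using Ti z by (intro additive_on_sum[OF \<phi>(3) V(2) V(1)] V(2) b; simp)+
      have "(\<Sum>j\<in>Ti. \<phi> (b j + b z)) = (\<Sum>j\<in>Ti. W j)"
        using Ti z by (intro sum.cong) (simp_all add: W_def \<phi>(3) b)
      also have "\<dots> = 0" using W0[of i] j0 by (simp add: I_def i_def Ti_def)
      finally have "(\<Sum>j\<in>Ti. b j + b z) = 0"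
        using hom \<phi>(2) in_V V(1) zero by (metis inj_onD)
      hence "(\<Sum>j\<in>Ti. b j + b z) k = 0" for k by simp
      hence b0: "(\<Sum>j\<in>Ti. b j k + b z k) = 0" for k by (simp add: sum_fun_apply)
      \<comment> \<open>\<open>b z\<close> occurs \<open>card Ti\<close> times in the sum, hence only its parity counts.\<close>
      define T' where "T' = (if even (card Ti) then Ti else insert z Ti)"
      have "T' = {}"
      proof (rule odd_power_sums_independent[OF char, where x = "\<lambda>j. a (j mod r)" and t = t])
        show "finite T'" "even (card T')" using finTi z by (auto simp: T'_def)
        have "card Ti \<le> card T" using finT by (intro card_mono) (auto simp: Ti_def)
        hence "card Ti \<le> 2 * t" using T assms by linarith
        thus "card T' \<le> 2 * t + 1" using finTi z by (simp add: T'_def)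
        \<comment> \<open>Within one group the position \<open>j mod r\<close> determines
          \<open>j\<close>, so the nodes are distinct.\<close>
        have "j div r = i" "j mod r < r" if "j \<in> T'" for j
          using that Ti z r by (auto simp: T'_def split: if_splits)
        thus "inj_on (\<lambda>j. a (j mod r)) T'"
          using a(2) by (intro inj_onI) (metis div_mult_mod_eq inj_onD lessThan_iff)
        fix k assume k: "k < t"
        have two: "of_nat (card Ti) = (if even (card Ti) then 0 else 1 :: 'a)"
        proof (cases "even (card Ti)")
          case True thus ?thesis using char by (simp add: of_nat_eq_0_iff_char_dvd)
        next
          case False
          then obtain c where "card Ti = 2 * c + 1" by (elim oddE)
          moreover have "of_nat (2 * c) = (0::'a)" by (subst of_nat_eq_0_iff_char_dvd) (simp add: char)
          ultimately show ?thesis by (simp del: of_nat_mult)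
        qed
        have "0 = (\<Sum>j\<in>Ti. a (j mod r) ^ (2 * k + 1)) + of_nat (card Ti) * a (z mod r) ^ (2 * k + 1)"
          using b0[of k] k by (simp add: b_def sum.distrib)
        also have "\<dots> = (\<Sum>j\<in>T'. a (j mod r) ^ (2 * k + 1))"
          unfolding two T'_def using finTi z by (simp add: add.commute)
        finally show "(\<Sum>j\<in>T'. a (j mod r) ^ (2 * k + 1)) = 0" by simp
      qed
      moreover have "j0 \<in> T'" using j0 by (simp add: T'_def Ti_def i_def)
      ultimately show False by blast
    qed
  qed
qed

text \<open>Fix a pivot \<open>p i\<close> of \<open>S\<close> in each group. The local relations
  allow \<open>y j\<close> to be replaced by \<open>y j + y (p (j div r))\<close> in the global
  rows; this vanishes at the pivots and leaves a Moore system on the other \<open>h\<close>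
  columns.\<close>

lemma local_global_independent:
  fixes y d :: "nat \<Rightarrow> 'a::field"
  assumes char: "CHAR('a) = 2"
    and gen: "\<And>T p. T \<subseteq> {..<g * r} \<Longrightarrow> card T \<le> h \<Longrightarrow>
      (\<And>j. j \<in> T \<Longrightarrow> p (j div r) < g * r \<and> p (j div r) div r = j div r \<and> p (j div r) \<notin> T) \<Longrightarrow>
      (\<Sum>j\<in>T. y j + y (p (j div r))) = 0 \<Longrightarrow> T = {}"
    and S: "S \<subseteq> {..<g * r}" "card S = g + h" "\<And>i. i < g \<Longrightarrow> \<exists>j\<in>S. j div r = i"
    and loc: "\<And>i. i < g \<Longrightarrow> (\<Sum>j | j \<in> S \<and> j div r = i. d j) = 0"
    and glob: "\<And>k. k < h \<Longrightarrow> (\<Sum>j\<in>S. d j * y j ^ (2 ^ k)) = 0" and "j \<in> S"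
  shows "d j = 0"
proof -
  have finS: "finite S" using S finite_subset by blast
  have Slt: "j < g * r" "j div r < g" if "j \<in> S" for j
    using S that by (auto simp: less_mult_imp_div_less)
  obtain p where p: "\<And>i. i < g \<Longrightarrow> p i \<in> S" "\<And>i. i < g \<Longrightarrow> p i div r = i"
    using S(3) by metis
  define R where "R = S - p ` {..<g}"
  have "inj_on p {..<g}" using p(2) by (metis inj_onI lessThan_iff)
  hence card_R: "card R = h"
    using S p finS by (simp add: R_def card_Diff_subset card_image image_subset_iff)
  have "p (j div r) = j" if "j \<in> S - R" for j using that p(2) by (auto simp: R_def)
  hence yy: "y j + y (p (j div r)) = 0" if "j \<in> S - R" for j
    using that char_two_add_self[OF char] by simp
  have R0: "d j = 0" if "j \<in> R" for j
  proof (rule moore_independent[OF char, where I = R and y = "\<lambda>j. y j + y (p (j div r))"])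
    show "finite R" "j \<in> R" using finS that by (auto simp: R_def)
    show "T = {}" if "T \<subseteq> R" "(\<Sum>j\<in>T. y j + y (p (j div r))) = 0" for T
    proof (rule gen[OF _ _ _ that(2)])
      have "card T \<le> card R" using that finS by (intro card_mono) (auto simp: R_def)
      thus "card T \<le> h" using card_R by simp
      have "T \<subseteq> S" using that by (auto simp: R_def)
      thus "T \<subseteq> {..<g * r}" using S by blast
      show "p (j div r) < g * r \<and> p (j div r) div r = j div r \<and> p (j div r) \<notin> T" if "j \<in> T" for j
        using \<open>T \<subseteq> S\<close> \<open>T \<subseteq> R\<close> that Slt[of j] Slt(1)[OF p(1)] p(2) by (auto simp: R_def)
    qed
    fix k assume k: "k < card R"
    \<comment> \<open>The pivot term is constant on each group, so it factors out of the local
      relation.\<close>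
    have "(\<Sum>j\<in>S. d j * y (p (j div r)) ^ (2 ^ k)) =
      (\<Sum>i<g. \<Sum>j | j \<in> S \<and> j div r = i. d j * y (p (j div r)) ^ (2 ^ k))"
      using finS Slt by (intro sum.group[symmetric]) auto
    also have "\<dots> = (\<Sum>i<g. (\<Sum>j | j \<in> S \<and> j div r = i. d j) * y (p i) ^ (2 ^ k))"
      by (simp add: sum_distrib_right)
    also have "\<dots> = 0" using loc by simp
    finally have "(\<Sum>j\<in>S. d j * (y j + y (p (j div r))) ^ (2 ^ k)) = 0"
      using glob[of k] k card_R by (simp add: frobenius_add[OF char] distrib_left sum.distrib)
    moreover have "(\<Sum>j\<in>S. d j * (y j + y (p (j div r))) ^ (2 ^ k)) =
      (\<Sum>j\<in>R. d j * (y j + y (p (j div r))) ^ (2 ^ k))"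
      using finS yy by (intro sum.mono_neutral_right) (auto simp: R_def power_0_left)
    ultimately show "(\<Sum>j\<in>R. d j * (y j + y (p (j div r))) ^ (2 ^ k)) = 0" by simp
  qed
  show ?thesis
  proof (cases "j \<in> R")
    case False
    then obtain i where i: "i < g" "j = p i" using \<open>j \<in> S\<close> by (auto simp: R_def)
    \<comment> \<open>Once the other coefficients vanish, the local relation of group
      \<open>i\<close> reduces to its pivot.\<close>
    have "0 = (\<Sum>j | j \<in> S \<and> j div r = i. d j)" using loc i by simp
    also have "\<dots> = (\<Sum>j\<in>{p i}. d j)"
      using finS p i by (intro sum.mono_neutral_right) (auto intro!: R0 simp: R_def)
    finally show ?thesis using i by simp
  qed (use R0 in simp)
qed

subsection \<open>Transport to a field on natural numbers\<close>

text \<open>\<open>exists_MR_LRC\<close> speaks of records on \<open>nat\<close>, while the algebra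
  takes place in a type class field; numbering the elements of a finite subfield carries the
  structure over.\<close>

lemma finite_field_on_nat:
  fixes A :: "'a::field set"
  assumes "finite A" and A: "1 \<in> A" "\<And>x y. x \<in> A \<Longrightarrow> y \<in> A \<Longrightarrow> x + y \<in> A"
    "\<And>x. x \<in> A \<Longrightarrow> - x \<in> A" "\<And>x y. x \<in> A \<Longrightarrow> y \<in> A \<Longrightarrow> x * y \<in> A" "\<And>x. x \<in> A \<Longrightarrow> inverse x \<in> A"
  obtains F :: "nat ring" and e where "Ring.field F" "bij_betw e (carrier F) A"
    "e \<zero>\<^bsub>F\<^esub> = 0" "e \<one>\<^bsub>F\<^esub> = 1"
    "\<And>x y. x \<in> carrier F \<Longrightarrow> y \<in> carrier F \<Longrightarrow> e (x \<oplus>\<^bsub>F\<^esub> y) = e x + e y"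
    "\<And>x y. x \<in> carrier F \<Longrightarrow> y \<in> carrier F \<Longrightarrow> e (x \<otimes>\<^bsub>F\<^esub> y) = e x * e y"
proof -
  obtain e where e: "bij_betw e {0..<card A} A" using ex_bij_betw_nat_finite[OF \<open>finite A\<close>] by blast
  define C where "C = {0..<card A}"
  define f where "f = inv_into C e"
  have ef: "e (f x) = x" "f x \<in> C" if "x \<in> A" for x
  proof -
    have "x \<in> e ` C" using that e by (simp add: C_def bij_betw_def)
    thus "e (f x) = x" "f x \<in> C" unfolding f_def by (rule f_inv_into_f, rule inv_into_into)
  qed
  have fe: "f (e x) = x" "e x \<in> A" if "x \<in> C" for x
    using that e by (auto simp: f_def C_def bij_betw_def)
  have A0: "0 \<in> A" using A(2)[OF A(1) A(3)[OF A(1)]] by simp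
  define F :: "nat ring" where "F = \<lparr>carrier = C, monoid.mult = \<lambda>x y. f (e x * e y), one = f 1,
    zero = f 0, add = \<lambda>x y. f (e x + e y)\<rparr>"
  have F [simp]: "carrier F = C" "x \<otimes>\<^bsub>F\<^esub> y = f (e x * e y)" "\<one>\<^bsub>F\<^esub> = f 1" "\<zero>\<^bsub>F\<^esub> = f 0"
    "x \<oplus>\<^bsub>F\<^esub> y = f (e x + e y)" for x y
    by (simp_all add: F_def)
  have "abelian_group F"
  proof (rule abelian_groupI)
    show "\<exists>z\<in>carrier F. z \<oplus>\<^bsub>F\<^esub> x = \<zero>\<^bsub>F\<^esub>" if "x \<in> carrier F" for x
      using that by (intro bexI[of _ "f (- e x)"]) (simp_all add: ef fe A)
  qed (simp_all add: ef fe A A0 ac_simps)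
  moreover have "comm_monoid F"
    by (rule comm_monoidI) (simp_all add: ef fe A ac_simps)
  ultimately have "cring F"
    by (rule cringI) (simp_all add: ef fe A distrib_right)
  moreover have "\<exists>z\<in>carrier F. x \<otimes>\<^bsub>F\<^esub> z = \<one>\<^bsub>F\<^esub>" if "x \<in> carrier F" "x \<noteq> \<zero>\<^bsub>F\<^esub>" for x
  proof (rule bexI[of _ "f (inverse (e x))"])
    have "e x \<noteq> 0" using that fe[of x] by auto
    thus "x \<otimes>\<^bsub>F\<^esub> f (inverse (e x)) = \<one>\<^bsub>F\<^esub>" using that by (simp add: ef fe A)
  qed (use that in \<open>simp add: ef fe A\<close>)
  moreover have "\<zero>\<^bsub>F\<^esub> \<noteq> \<one>\<^bsub>F\<^esub>" using ef(1)[OF A0] ef(1)[OF A(1)] by auto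
  ultimately have "Ring.field F" by (intro cring.cring_fieldI2)
  thus ?thesis
    by (rule that[of F e]) (use e in \<open>simp_all add: ef fe A A0 C_def[symmetric]\<close>)
qed

section \<open>The parity-check matrix over the transported field\<close>

lemma (in abelian_monoid) additive_finsum:
  assumes e: "e \<zero> = (0::'c::comm_monoid_add)"
    "\<And>x y. x \<in> carrier G \<Longrightarrow> y \<in> carrier G \<Longrightarrow> e (x \<oplus> y) = e x + e y"
    and "finite S" "w \<in> S \<rightarrow> carrier G"
  shows "e (\<Oplus>i\<in>S. w i) = (\<Sum>i\<in>S. e (w i))"
  using assms(3,4)
proof (induction S rule: finite_induct)
  case (insert i S)
  hence "w \<in> S \<rightarrow> carrier G" "w i \<in> carrier G" by auto
  thus ?case using insert by (simp add: e(2))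
qed (simp add: e)

text \<open>This is the repetition code: a nonzero codeword is constant and so has full weight
  \<open>r = r - 1 + 1\<close>.\<close>

lemma generates_MDS_ones:
  assumes "Ring.field F" "r > 0" "\<And>j. j < r \<Longrightarrow> A 0 j = \<one>\<^bsub>F\<^esub>"
  shows "generates_MDS F 1 r A"
proof -
  interpret Ring.field F by fact
  have cw: "codeword F 1 A c j = c 0" if "c \<in> {0..<1} \<rightarrow> carrier F" "j < r" for c j
    using that assms by (simp add: codeword_def Pi_iff)
  have wt: "hweight F r (codeword F 1 A c) = r" if "c \<in> {0..<1} \<rightarrow> carrier F" "c 0 \<noteq> \<zero>\<^bsub>F\<^esub>" for c
  proof -
    have "{j. j < r \<and> codeword F 1 A c j \<noteq> \<zero>\<^bsub>F\<^esub>} = {..<r}" using that by (auto simp: cw[OF that(1), unfolded One_nat_def])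
    thus ?thesis by (simp add: hweight_def)
  qed
  have "{hweight F r (codeword F 1 A c) | c. c \<in> {0..<1} \<rightarrow> carrier F \<and> (\<exists>i<1. c i \<noteq> \<zero>\<^bsub>F\<^esub>)} = {r}"
    (is "?L = _")
  proof
    show "?L \<subseteq> {r}" using wt by auto
    have "r = hweight F r (codeword F 1 A (\<lambda>_. \<one>\<^bsub>F\<^esub>))" by (subst wt) auto
    thus "{r} \<subseteq> ?L" by (auto intro!: exI[of _ "\<lambda>_. \<one>\<^bsub>F\<^esub>"])
  qed
  moreover have "c 0 = \<zero>\<^bsub>F\<^esub>"
    if "c \<in> {0..<1} \<rightarrow> carrier F" "\<forall>j<r. codeword F 1 A c j = \<zero>\<^bsub>F\<^esub>" for c
    using that cw[OF that(1), of 0] \<open>r > 0\<close> by simp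
  ultimately show ?thesis
    unfolding generates_MDS_def using \<open>r > 0\<close> by auto
qed

lemma MR_LRC_of_generators:
  fixes y :: "nat \<Rightarrow> 'a::alg_closed_field"
  assumes char: "CHAR('a) = 2" and N: "N > 0" and "r > 0" and y: "\<And>j. j < g * r \<Longrightarrow> y j \<in> GF N"
    and gen: "\<And>T p. T \<subseteq> {..<g * r} \<Longrightarrow> card T \<le> h \<Longrightarrow>
      (\<And>j. j \<in> T \<Longrightarrow> p (j div r) < g * r \<and> p (j div r) div r = j div r \<and> p (j div r) \<notin> T) \<Longrightarrow>
      (\<Sum>j\<in>T. y j + y (p (j div r))) = 0 \<Longrightarrow> T = {}"
  obtains F :: "nat ring" where "Ring.field F" "finite (carrier F)" "card (carrier F) = 2 ^ N"
    "exists_MR_LRC F g r h 1"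
proof -
  obtain F :: "nat ring" and e where F: "Ring.field F" and e: "bij_betw e (carrier F) (GF N :: 'a set)"
    and e_simps: "e \<zero>\<^bsub>F\<^esub> = 0" "e \<one>\<^bsub>F\<^esub> = 1"
    "\<And>x y. x \<in> carrier F \<Longrightarrow> y \<in> carrier F \<Longrightarrow> e (x \<oplus>\<^bsub>F\<^esub> y) = e x + e y"
    "\<And>x y. x \<in> carrier F \<Longrightarrow> y \<in> carrier F \<Longrightarrow> e (x \<otimes>\<^bsub>F\<^esub> y) = e x * e y"
  proof (rule finite_field_on_nat[of "GF N :: 'a set"])
    show "finite (GF N :: 'a set)" using char N by (rule card_GF)
    show "- x \<in> GF N" if "x \<in> GF N" for x :: 'a using that by (simp add: uminus_CHAR_2[OF char])
  qed (use GF_add[OF char] in auto)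
  interpret Ring.field F by fact
  define f where "f = inv_into (carrier F) e"
  have ef: "e (f x) = x" "f x \<in> carrier F" if "x \<in> GF N" for x
    using that e by (auto simp: f_def bij_betw_def f_inv_into_f inv_into_into)
  have f01: "f 0 = \<zero>\<^bsub>F\<^esub>" "f 1 = \<one>\<^bsub>F\<^esub>"
    using inv_into_f_f[OF bij_betw_imp_inj_on[OF e] zero_closed]
      inv_into_f_f[OF bij_betw_imp_inj_on[OF e] one_closed] e_simps by (simp_all add: f_def)
  \<comment> \<open>Rows below \<open>g\<close> are the all-one local rows, and row
    \<open>g + k\<close> is the Moore row with exponent \<open>2 ^ k\<close>.\<close>
  define M where "M i j = (if i < g then if j div r = i then 1 else 0 else y j ^ (2 ^ (i - g)))" for i j
  have M: "M i j \<in> GF N" if "j < g * r" for i j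
    using GF_power[OF y[OF that]] by (simp add: M_def)
  define H where "H i j = f (M i j)" for i j
  have "MR_LRC_pcm F g r h 1 H"
    unfolding MR_LRC_pcm_def
  proof (intro conjI allI impI)
    show "H i j \<in> carrier F" if "j < g * r" for i j using M[OF that] by (simp add: H_def ef)
    show "H i j = \<zero>\<^bsub>F\<^esub>" if "i < g * 1" "i div 1 \<noteq> j div r" for i j
      using that by (simp add: H_def M_def f01)
    show "generates_MDS F 1 r (\<lambda>i j. H (t * 1 + i) (t * r + j))" if "t < g" for t
      using F \<open>r > 0\<close> that by (intro generates_MDS_ones) (simp_all add: H_def M_def f01)
  next
    fix S assume "S \<subseteq> {0..<g * r} \<and> card S = 1 * g + h \<and> (\<forall>t<g. 1 \<le> card {j \<in> S. j div r = t})"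
    hence S: "S \<subseteq> {..<g * r}" "card S = g + h" "\<And>t. t < g \<Longrightarrow> card {j \<in> S. j div r = t} \<noteq> 0"
      by (simp_all add: lessThan_atLeast0 Suc_le_eq)
    have finS: "finite S" using S(1) by (rule finite_subset) simp
    show "cols_lin_indep F (g * 1 + h) H S"
      unfolding cols_lin_indep_def
    proof (intro ballI impI)
      fix c j
      assume c: "c \<in> S \<rightarrow> carrier F" and "j \<in> S"
        and eqs: "\<forall>i<g * 1 + h. (\<Oplus>\<^bsub>F\<^esub>j\<in>S. c j \<otimes>\<^bsub>F\<^esub> H i j) = \<zero>\<^bsub>F\<^esub>"
      \<comment> \<open>Applying \<open>e\<close> turns a column relation over \<open>F\<close> into
        one in the ambient field.\<close>
      have sum: "(\<Sum>j\<in>S. e (c j) * M i j) = 0" if "i < g + h" for i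
      proof -
        have H: "H i j \<in> carrier F" "e (H i j) = M i j" if "j \<in> S" for j
        proof -
          have "M i j \<in> GF N" using S(1) that by (intro M) auto
          thus "H i j \<in> carrier F" "e (H i j) = M i j" by (simp_all add: H_def ef)
        qed
        hence "(\<Sum>j\<in>S. e (c j) * M i j) = (\<Sum>j\<in>S. e (c j \<otimes>\<^bsub>F\<^esub> H i j))"
          using c by (intro sum.cong) (simp_all add: e_simps(4) Pi_iff)
        also have "\<dots> = e (\<Oplus>\<^bsub>F\<^esub>j\<in>S. c j \<otimes>\<^bsub>F\<^esub> H i j)"
          using c finS H(1)
          by (intro additive_finsum[symmetric]) (simp_all add: e_simps(1,3) Pi_iff)
        also have "\<dots> = 0" using eqs that by (simp add: e_simps)
        finally show ?thesis .
      qed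
      have "e (c j) = 0"
      proof (rule local_global_independent[OF char gen, where S = S and d = "\<lambda>j. e (c j)"])
        show "S \<subseteq> {..<g * r}" "card S = g + h" "j \<in> S" by fact+
        show "\<exists>j\<in>S. j div r = i" if "i < g" for i
        proof -
          have "{j \<in> S. j div r = i} \<noteq> {}" using S(3)[OF that] card.empty by metis
          thus ?thesis by blast
        qed
        show "(\<Sum>j | j \<in> S \<and> j div r = i. e (c j)) = 0" if "i < g" for i
        proof -
          have "(\<Sum>j | j \<in> S \<and> j div r = i. e (c j)) = (\<Sum>j\<in>S. e (c j) * M i j)"
            using finS that by (intro sum.mono_neutral_cong_left) (auto simp: M_def)
          thus ?thesis using sum[of i] that by simp
        qed
        show "(\<Sum>j\<in>S. e (c j) * y j ^ (2 ^ k)) = 0" if "k < h" for k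
          using sum[of "g + k"] that by (simp add: M_def)
      qed
      moreover have "c j \<in> carrier F" using c \<open>j \<in> S\<close> by auto
      ultimately show "c j = \<zero>\<^bsub>F\<^esub>"
        using inj_onD[OF bij_betw_imp_inj_on[OF e], of "c j" "\<zero>\<^bsub>F\<^esub>"] e_simps(1) by simp
    qed
  qed
  thus ?thesis
    using F card_GF[OF char N] bij_betw_same_card[OF e] bij_betw_finite[OF e]
    by (intro that[of F]) (auto simp: exists_MR_LRC_def)
qed

section \<open>Choice of the parameters and the size bound\<close>

lemma ex_power_two_between:
  assumes "n > 0"
  shows "\<exists>k. n \<le> 2 ^ k \<and> 2 ^ k < 2 * (n::nat)"
proof (cases "n = 1")
  case False
  hence "\<exists>k. 2 ^ k < n \<and> n \<le> 2 ^ (k + 1)" using assms by (intro ex_power_ivl2) auto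
  then obtain k where "2 ^ k < n" "n \<le> 2 ^ (k + 1)" by blast
  thus ?thesis by (intro exI[of _ "k + 1"]) auto
qed (auto intro: exI[of _ 0])

theorem theorem3p9:
  shows "\<exists>C::real. \<exists>e::nat. C > 0 \<and>
    (\<forall>r h g :: nat. 0 < r \<and> 0 < h \<and> 0 < g \<and> r \<ge> h + 2 \<and> g + h < g * r \<longrightarrow>
      (\<exists>F :: nat ring. field F \<and> finite (carrier F) \<and>
         real (card (carrier F)) \<le>
           (max (C * real g * (log 2 (real g + 1)) ^ e) (real ((2 * r) ^ ((h + 1) div 2))))
             ^ (min h g) \<and>
         exists_MR_LRC F g r h 1))"
proof (rule exI[of _ 2], rule exI[of _ 0], intro conjI allI impI)
  fix r h g :: nat
  assume asm: "0 < r \<and> 0 < h \<and> 0 < g \<and> r \<ge> h + 2 \<and> g + h < g * r"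
  define t m where "t = (h + 1) div 2" and "m = min h g"
  \<comment> \<open>Rounding up to a power of two costs less than a factor 2; this yields
    \<open>2 * r\<close> in the bound here, and the constant \<open>C = 2\<close> for
    \<open>g\<close> below.\<close>
  obtain s where s: "r \<le> 2 ^ s" "2 ^ s < 2 * r" using ex_power_two_between[of r] asm by blast
  obtain v where v: "g \<le> 2 ^ v" "2 ^ v < 2 * g" using ex_power_two_between[of g] asm by blast
  \<comment> \<open>\<open>GF u\<close> must hold the BCH vectors, of which there are
    \<open>2 ^ (s * t)\<close>, and one distinct node per group.\<close>
  define u where "u = max (s * t) v"
  have s0: "s > 0" using s asm by (intro Nat.gr0I) auto
  have t: "t > 0" "h \<le> 2 * t" using asm by (auto simp: t_def)
  have u: "u > 0" "s * t \<le> u" using s0 t by (auto simp: u_def less_max_iff_disj)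
  have m: "m > 0" using asm by (simp add: m_def)
  have "(2::nat) ^ v \<le> 2 ^ u" by (intro power_increasing) (auto simp: u_def)
  hence g: "g \<le> 2 ^ u" using v(1) by (rule order_trans[rotated])
  have "(2 ^ s) ^ t \<le> (2 * r) ^ t" using s by (intro power_mono) auto
  \<comment> \<open>\<open>u\<close> equals one of the two exponents, and each power has its own
    bound.\<close>
  hence "2 ^ u \<le> max (2 * g) ((2 * r) ^ t)"
    using v by (cases "s * t \<le> v") (auto simp: u_def max_def power_mult)
  hence "real (2 ^ u) \<le> real (max (2 * g) ((2 * r) ^ t))" by (simp only: of_nat_le_iff)
  hence "real (2 ^ u) ^ m \<le> real (max (2 * g) ((2 * r) ^ t)) ^ m" by (intro power_mono) auto
  hence bound: "real (2 ^ (u * m)) \<le> max (2 * real g) (real ((2 * r) ^ t)) ^ m"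
    by (simp add: power_mult of_nat_max)
  obtain y :: "nat \<Rightarrow> bit alg_closure" where y: "\<And>j. j < g * r \<Longrightarrow> y j \<in> GF (u * m)"
    and gen: "\<And>T p. T \<subseteq> {..<g * r} \<Longrightarrow> card T \<le> h \<Longrightarrow>
      (\<And>j. j \<in> T \<Longrightarrow> p (j div r) < g * r \<and> p (j div r) div r = j div r \<and> p (j div r) \<notin> T) \<Longrightarrow>
      (\<Sum>j\<in>T. y j + y (p (j div r))) = 0 \<Longrightarrow> T = {}"
    using column_generators[OF char_two_alg_closure_bit s0 s(1) u g m _ t(2)] unfolding m_def by blast
  obtain F :: "nat ring" where "Ring.field F" "finite (carrier F)" "card (carrier F) = 2 ^ (u * m)"
    "exists_MR_LRC F g r h 1"
  proof (rule MR_LRC_of_generators[OF char_two_alg_closure_bit, of "u * m" r g y h])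
    show "T = {}" if "T \<subseteq> {..<g * r}" "card T \<le> h"
      "\<And>j. j \<in> T \<Longrightarrow> p (j div r) < g * r \<and> p (j div r) div r = j div r \<and> p (j div r) \<notin> T"
      "(\<Sum>j\<in>T. y j + y (p (j div r))) = 0" for T p
      using that by (rule gen)
  qed (use u m asm y in auto)
  thus "\<exists>F :: nat ring. field F \<and> finite (carrier F) \<and>
      real (card (carrier F)) \<le>
        (max (2 * real g * (log 2 (real g + 1)) ^ 0) (real ((2 * r) ^ ((h + 1) div 2)))) ^ (min h g) \<and>
      exists_MR_LRC F g r h 1"
    using bound by (intro exI[of _ F]) (simp add: t_def m_def)
qed simp

end
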